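(* Let $\boldsymbol l=(l_1,\dots,l_r)$ be a partition ($l_1\ge\dots\ge l_r\ge0$ integers) and let $i\in\{0,\dots,r\}$ (then $\boldsymbol l+\boldsymbol 1_i$ is also a partition). As polynomials in $x$ with coefficients rational functions of the complex parameters $\boldsymbol m=(m_1,\dots,m_r)$ and $k$, $$D_i(\boldsymbol l,k)\,P(\boldsymbol l,k)=A_i(\boldsymbol l,k)\,P(\boldsymbol l+\boldsymbol 1_i,k+1).$$
   Context: Fix $r\ge1$ and a sequence $\boldsymbol m=(m_1,\dots,m_r)$ of complex numbers, and put $l_0=k$, $l_{r+1}=0$. $\boldsymbol 1_i=(1,\dots,1,0,\dots,0)\in\mathbb Z^r$ has its first $i$ entries equal to $1$ and the others equal to $0$. Put $e_i(\boldsymbol l,k)=k+\sum_{s=1}^im_s-l_i+l_{i+1}+i$ (so $e_0(\boldsymbol l,k)=l_1$) and $$D_i(\boldsymbol l,k)=x(x-1)\frac{d}{dx}-e_i(\boldsymbol l,k)(x-1)-k-1,\qquad i=0,\dots,r.$$ The constants are $$A_0(\boldsymbol l,k)=\prod_{s=0}^r\frac{k+\sum_{j=1}^sm_j-l_1+s+1}{k+\sum_{j=1}^sm_j-l_1+s+1+l_{s+1}-l_s},$$ $$A_i(\boldsymbol l,k)=e_0(\boldsymbol l,k)-e_i(\boldsymbol l,k)=l_1-\sum_{s=1}^im_s-k+l_i-l_{i+1}-i\qquad(i=1,\dots,r).$$ The Jacobi-Piñeiro polynomial $P(\boldsymbol l,k)=P(\boldsymbol m,\boldsymbol l,k)$ is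 the monic polynomial of degree $l_1$ in $x$ proportional to $$(x-1)^{k+1}\tilde D_r\tilde D_{r-1}\cdots\tilde D_1\big((x-1)^{l_1-k-1}\big),\qquad \tilde D_i=x^{\sum_{j=1}^im_j+i}\,\frac{d^{\,l_i-l_{i+1}}}{dx^{\,l_i-l_{i+1}}}\,x^{l_i-l_{i+1}-\sum_{j=1}^im_j-i},$$ where $\tilde D_i$ is the composition of multiplication by a power of $x$, repeated differentiation, and multiplication by a power of $x$; the coefficients of $P(\boldsymbol l,k)$ are rational functions of $\boldsymbol m,k$ with coefficients in $\mathbb Q$.
   Formalization: For i=0 the constant is taken as minus the printed product A_0: the printed sign is wrong, e.g. for l=(0,...,0) one has P=1 and D_0 1=-(k+1), while the printed A_0 equals k+1. The case i≥1 is as printed. *)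

theory Defs
  imports
    "HOL-Analysis.Analysis"
    "HOL-Library.Poly_Mapping"
    "HOL-Computational_Algebra.Polynomial"
    "HOL-Computational_Algebra.Fraction_Field"
begin

section \<open>Rational functions of the parameters\<close>

text \<open>
  Polynomials over the rationals in countably many indeterminates, a monomial being a finitely
  supported exponent vector, and their field of fractions. Indeterminate 0 is \<open>k\<close>,
  indeterminate \<open>j \<ge> 1\<close> is \<open>m\<^sub>j\<close>; those beyond \<open>r\<close> do not occur in anything below.
\<close>

type_synonym param_poly = "(nat \<Rightarrow>\<^sub>0 nat) \<Rightarrow>\<^sub>0 rat"
type_synonym param_ratfun = "param_poly fract"

definition param :: "nat \<Rightarrow> param_ratfun" where
  "param j = Fract (Poly_Mapping.single (Poly_Mapping.single j 1) 1) 1"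

definition param_poly_eval :: "(nat \<Rightarrow> complex) \<Rightarrow> param_poly \<Rightarrow> complex" where
  "param_poly_eval v p =
     (\<Sum>\<alpha>\<in>Poly_Mapping.keys p. of_rat (Poly_Mapping.lookup p \<alpha>) *
        (\<Prod>j\<in>Poly_Mapping.keys \<alpha>. v j ^ Poly_Mapping.lookup \<alpha> j))"

definition regular_at :: "(nat \<Rightarrow> complex) \<Rightarrow> param_ratfun \<Rightarrow> bool" where
  "regular_at v f \<longleftrightarrow> (\<exists>a b. f = Fract a b \<and> param_poly_eval v b \<noteq> 0)"

definition ratfun_eval :: "(nat \<Rightarrow> complex) \<Rightarrow> param_ratfun \<Rightarrow> complex" where
  "ratfun_eval v f =
     (THE y. \<exists>a b. f = Fract a b \<and> param_poly_eval v b \<noteq> 0 \<and>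
                   y = param_poly_eval v a / param_poly_eval v b)"

section \<open>Partitions\<close>

text \<open>
  A partition \<open>(l\<^sub>1, \<dots>, l\<^sub>r)\<close> is a function on naturals of which only the values at
  \<open>1, \<dots>, r\<close> matter; \<open>part r l\<close> enforces \<open>l\<^sub>r\<^sub>+\<^sub>1 = 0\<close>, and \<open>part_ext r l k\<close> moreover
  has the value \<open>k\<close>, which is in general not an integer, at index 0.
\<close>

definition part :: "nat \<Rightarrow> (nat \<Rightarrow> nat) \<Rightarrow> nat \<Rightarrow> nat" where
  "part r l i = (if 1 \<le> i \<and> i \<le> r then l i else 0)"

definition part_ext :: "nat \<Rightarrow> (nat \<Rightarrow> nat) \<Rightarrow> 'a::field \<Rightarrow> nat \<Rightarrow> 'a" where
  "part_ext r l k i = (if i = 0 then k else of_nat (part r l i))"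

definition is_part :: "nat \<Rightarrow> (nat \<Rightarrow> nat) \<Rightarrow> bool" where
  "is_part r l \<longleftrightarrow> (\<forall>j. 1 \<le> j \<and> j < r \<longrightarrow> l (Suc j) \<le> l j)"

definition add_ones :: "(nat \<Rightarrow> nat) \<Rightarrow> nat \<Rightarrow> nat \<Rightarrow> nat" where
  "add_ones l i = (\<lambda>j. if 1 \<le> j \<and> j \<le> i then l j + 1 else l j)"

section \<open>Jacobi-Pineiro polynomials\<close>

text \<open>
  For complex parameters the operators \<open>\<D>\<^sub>i\<close> with tilde act on functions of a complex variable.
  On the plane cut along \<open>(-\<infinity>, 1]\<close> the principal branches of all occurring powers of \<open>x\<close> and of
  \<open>x - 1\<close> are holomorphic, so that the iterated complex derivatives there are the expected ones.
\<close>

definition cut_plane :: "complex set" where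
  "cut_plane = - (complex_of_real ` {..1})"

definition Dtilde ::
  "nat \<Rightarrow> (nat \<Rightarrow> complex) \<Rightarrow> (nat \<Rightarrow> nat) \<Rightarrow> nat \<Rightarrow> (complex \<Rightarrow> complex) \<Rightarrow> complex \<Rightarrow> complex" where
  "Dtilde r m l i f =
     (let n = part r l i - part r l (Suc i); a = (\<Sum>j=1..i. m j) + of_nat i
      in (\<lambda>x. x powr a * (deriv ^^ n) (\<lambda>y. y powr (of_nat n - a) * f y) x))"

text \<open>\<open>fold\<close> applies the operator with index 1 first, the one with index \<open>r\<close> last.\<close>

definition rodrigues ::
  "nat \<Rightarrow> (nat \<Rightarrow> complex) \<Rightarrow> (nat \<Rightarrow> nat) \<Rightarrow> complex \<Rightarrow> complex \<Rightarrow> complex" where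
  "rodrigues r m l k =
     (\<lambda>x. (x - 1) powr (k + 1) *
        fold (Dtilde r m l) [1..<Suc r] (\<lambda>y. (y - 1) powr (of_nat (l 1) - k - 1)) x)"

text \<open>
  The polynomial is an element of \<open>\<rat>(m\<^sub>1, \<dots>, m\<^sub>r, k)[x]\<close>, monic of degree \<open>l\<^sub>1\<close> and proportional,
  with a factor \<open>c\<close> in the coefficient field, to the Rodrigues expression: the relation holds upon
  specialization to each complex parameter point \<open>v\<close> at which no denominator vanishes.
  The arguments \<open>m\<close>, \<open>k\<close> are themselves rational functions of the parameters, so that
  \<open>k\<close> may be replaced by \<open>k + 1\<close>.
\<close>

definition is_jacobi_pineiro ::
  "nat \<Rightarrow> (nat \<Rightarrow> param_ratfun) \<Rightarrow> (nat \<Rightarrow> nat) \<Rightarrow> param_ratfun \<Rightarrow> param_ratfun poly \<Rightarrow> bool" where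
  "is_jacobi_pineiro r m l k P \<longleftrightarrow>
     degree P = l 1 \<and> lead_coeff P = 1 \<and>
     (\<exists>c. c \<noteq> 0 \<and>
        (\<forall>v. (\<forall>f \<in> {c, k} \<union> m ` {1..r} \<union> set (coeffs P). regular_at v f) \<longrightarrow>
           (\<forall>x\<in>cut_plane.
              rodrigues r (\<lambda>j. ratfun_eval v (m j)) l (ratfun_eval v k) x =
                ratfun_eval v c * poly (map_poly (ratfun_eval v) P) x)))"

definition jacobi_pineiro ::
  "nat \<Rightarrow> (nat \<Rightarrow> param_ratfun) \<Rightarrow> (nat \<Rightarrow> nat) \<Rightarrow> param_ratfun \<Rightarrow> param_ratfun poly" where
  "jacobi_pineiro r m l k = (THE P. is_jacobi_pineiro r m l k P)"

section \<open>The differential operators and the constants\<close>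

definition jp_e :: "nat \<Rightarrow> (nat \<Rightarrow> 'a::field) \<Rightarrow> (nat \<Rightarrow> nat) \<Rightarrow> 'a \<Rightarrow> nat \<Rightarrow> 'a" where
  "jp_e r m l k i =
     k + (\<Sum>s=1..i. m s) - part_ext r l k i + part_ext r l k (Suc i) + of_nat i"

definition jp_D ::
  "nat \<Rightarrow> (nat \<Rightarrow> 'a::field) \<Rightarrow> (nat \<Rightarrow> nat) \<Rightarrow> 'a \<Rightarrow> nat \<Rightarrow> 'a poly \<Rightarrow> 'a poly" where
  "jp_D r m l k i p =
     [:0, 1:] * [:-1, 1:] * pderiv p - smult (jp_e r m l k i) ([:-1, 1:] * p) - smult (k + 1) p"

text \<open>
  The minus sign in the case \<open>i = 0\<close> corrects a sign in the source, where the product appears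
  without it. For \<open>l = 0\<close> all polynomials are 1 and the product is \<open>k + 1\<close>, whereas
  \<open>D\<^sub>0\<close> maps 1 to \<open>-(k + 1)\<close>. In general the operator with index 0 multiplies the Rodrigues
  expression by \<open>l\<^sub>1 - k - 1\<close>, the negative of the factor \<open>s = 0\<close>, while raising \<open>k\<close> by 1.
\<close>

definition jp_A :: "nat \<Rightarrow> (nat \<Rightarrow> 'a::field) \<Rightarrow> (nat \<Rightarrow> nat) \<Rightarrow> 'a \<Rightarrow> nat \<Rightarrow> 'a" where
  "jp_A r m l k i =
     (if i = 0 then
        - (\<Prod>s=0..r.
            (k + (\<Sum>j=1..s. m j) - part_ext r l k 1 + of_nat s + 1) /
            (k + (\<Sum>j=1..s. m j) - part_ext r l k 1 + of_nat s + 1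
               + part_ext r l k (Suc s) - part_ext r l k s))
      else jp_e r m l k 0 - jp_e r m l k i)"

end

theory Submission
  imports Defs
begin

text \<open>
  The proof rests on writing everything in terms of the Euler operator \<open>\<theta> = x d/dx\<close>. Since
  \<open>x\<^sup>n d\<^sup>n/dx\<^sup>n = \<theta> (\<theta> - 1) \<dots> (\<theta> - n + 1)\<close>, the factor with index \<open>i\<close> of the Rodrigues
  expression is \<open>\<Prod>\<^sub>j (\<theta> - a\<^sub>i + j)\<close> with \<open>j = 1, \<dots>, l\<^sub>i - l\<^sub>i\<^sub>+\<^sub>1\<close> and
  \<open>a\<^sub>i = m\<^sub>1 + \<dots> + m\<^sub>i + i\<close>. Hence all these factors commute. Conjugating the operator
  \<open>D\<^sub>i\<close> by \<open>(x - 1)\<^sup>k\<^sup>+\<^sup>1\<close> turns it into multiplication by \<open>x - 1\<close> after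
  \<open>\<theta> + k + 1 - e\<^sub>i\<close>. For \<open>i \<ge> 1\<close> this is \<open>\<theta> - a\<^sub>i + l\<^sub>i - l\<^sub>i\<^sub>+\<^sub>1 + 1\<close>,
  precisely the one factor by which the product for \<open>l + 1\<^sub>i\<close> exceeds that for \<open>l\<close>, while
  \<open>l\<^sub>1 - k - 1\<close> does not change when \<open>l\<^sub>1\<close> and \<open>k\<close> both grow by one. For \<open>i = 0\<close> it is
  \<open>\<theta> - s\<close> with \<open>s = l\<^sub>1 - k - 1\<close>; moved to the front, it maps \<open>(x - 1)\<^sup>s\<close> to
  \<open>s (x - 1)\<^sup>s\<^sup>-\<^sup>1\<close>, the initial function for \<open>k + 1\<close>. So the identity holds for the
  unnormalized Rodrigues polynomials with factor \<open>1\<close> and \<open>s\<close>, respectively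
  (\<open>jp_D_jp_unnorm_raise\<close>, \<open>jp_D_jp_unnorm_0\<close>).

  The constants \<open>A\<^sub>i\<close> come from normalization alone. As \<open>(x - 1)\<^sup>s\<close> behaves like \<open>x\<^sup>s\<close> at
  infinity, where \<open>\<theta> + c\<close> acts as \<open>s + c\<close>, the leading coefficient is the product of
  all \<open>s + c\<close>; the quotients of such products telescope to \<open>A\<^sub>i\<close> (\<open>jp_D_jp_monic\<close>).

  To work over any field, a function \<open>(x - 1)\<^sup>s q(x)\<close> is represented by the polynomial \<open>q\<close>, so
  that \<open>\<theta> + c\<close> becomes the operator \<open>euler_step s c\<close> on polynomials. Over the complex numbers
  this computes the Rodrigues expression (\<open>rodrigues_eq_jp_unnorm\<close>). Since it involves only ring
  operations on the parameters, it commutes with specialization, which shows that the monic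
  multiple is a Jacobi-Pineiro polynomial. Conversely, there is only one, because two candidates
  can be compared at a complex parameter point avoiding finitely many denominators and zero sets
  (\<open>generic_point\<close>).
\<close>

section \<open>The Euler operator on multiples of powers of x - 1\<close>

text \<open>
  With \<open>\<theta> = x d/dx\<close>, the function \<open>(\<theta> + c) ((x - 1)\<^sup>s q)\<close> equals
  \<open>(x - 1)\<^sup>s\<^sup>-\<^sup>1 \<cdot> euler_step s c q\<close>. The exponent drops by one with each application, which is
  what the recursion of \<open>euler_steps\<close> records.
\<close>

definition euler_step :: "'a::field \<Rightarrow> 'a \<Rightarrow> 'a poly \<Rightarrow> 'a poly" where
  "euler_step s c q = [:0, 1:] * [:-1, 1:] * pderiv q + smult s ([:0, 1:] * q) + smult c ([:-1, 1:] * q)"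

fun euler_steps :: "'a::field \<Rightarrow> 'a list \<Rightarrow> 'a poly \<Rightarrow> 'a poly" where
  "euler_steps s [] q = q"
| "euler_steps s (c # cs) q = euler_steps (s - 1) cs (euler_step s c q)"

lemma euler_steps_append:
  "euler_steps s (xs @ ys) q = euler_steps (s - of_nat (length xs)) ys (euler_steps s xs q)"
  by (induction xs arbitrary: s q) (simp_all add: algebra_simps)

text \<open>
  \<open>\<theta> + c\<close> and \<open>\<theta> + d\<close> commute; in the formula for the composition below everything but
  the coefficient of \<open>q\<close> is visibly symmetric in \<open>c\<close> and \<open>d\<close>.
\<close>

lemma euler_step_commute:
  "euler_step (s - 1) c (euler_step s d q) = euler_step (s - 1) d (euler_step s c q)"
proof -
  define A :: "'a poly" where "A = [:0, 1:] * [:-1, 1:]"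
  define E where "E c = [:-c, s + c:]" for c
  have step: "euler_step s c q = A * pderiv q + E c * q" for c q
    by (rule poly_eqI) (simp add: euler_step_def A_def E_def coeff_pCons algebra_simps split: nat.split)
  have step': "euler_step (s - 1) c q = A * pderiv q + (E c - [:0, 1:]) * q" for c q
    by (rule poly_eqI) (simp add: euler_step_def A_def E_def coeff_pCons algebra_simps split: nat.split)
  have pE: "pderiv (E c) = [:s + c:]" for c
    by (simp add: E_def pderiv_pCons)
  have sym: "A * [:s + d:] + (E c - [:0, 1:]) * E d = A * [:s + c:] + (E d - [:0, 1:]) * E c"
    by (simp add: A_def E_def algebra_simps)
  have expand: "euler_step (s - 1) c (euler_step s d q) =
      A * pderiv A * pderiv q + A * A * pderiv (pderiv q) + A * (E c + E d - [:0, 1:]) * pderiv q +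
      (A * [:s + d:] + (E c - [:0, 1:]) * E d) * q" for c d
    unfolding step step' pderiv_add pderiv_mult pE by (simp only: algebra_simps)
  show ?thesis
    unfolding expand[of c d] expand[of d c] sym by (simp add: add.commute)
qed

lemma euler_steps_move:
  "euler_steps (s - 1) cs (euler_step s c q) = euler_step (s - of_nat (length cs)) c (euler_steps s cs q)"
proof (induction cs arbitrary: s q)
  case (Cons d cs)
  have "euler_steps (s - 1) (d # cs) (euler_step s c q) =
      euler_steps (s - 1 - 1) cs (euler_step (s - 1) c (euler_step s d q))"
    by (simp add: euler_step_commute[of s d c])
  also have "\<dots> = euler_step (s - 1 - of_nat (length cs)) c (euler_steps (s - 1) cs (euler_step s d q))"
    by (rule Cons.IH)
  finally show ?case by (simp add: algebra_simps)
qed simp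

text \<open>
  Owing to commutativity, the position of a factor in the product does not matter. This is what
  identifies an operator applied last with an additional factor in the middle of the Rodrigues
  expression.
\<close>

lemma euler_steps_insert:
  "euler_steps s (xs @ c # ys) q =
     euler_step (s - of_nat (length (xs @ ys))) c (euler_steps s (xs @ ys) q)"
  unfolding euler_steps_append euler_steps.simps euler_steps_move by (simp add: diff_diff_eq)

lemma euler_steps_smult: "euler_steps s cs (smult a q) = smult a (euler_steps s cs q)"
proof (induction cs arbitrary: s q)
  case (Cons c cs)
  have "euler_step s c (smult a q) = smult a (euler_step s c q)"
    by (rule poly_eqI) (simp add: euler_step_def pderiv_smult coeff_pCons algebra_simps split: nat.split)
  then show ?case using Cons by simp
qed simp

lemma coeff_euler_step:
  "coeff (euler_step s c q) n =
     (if n = 0 then 0 else (s + c + of_nat (n - 1)) * coeff q (n - 1)) - (c + of_nat n) * coeff q n"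
  by (cases n; cases "n - 1")
    (auto simp: euler_step_def coeff_pderiv coeff_pCons algebra_simps split: nat.splits)

lemma degree_euler_step: "degree q \<le> n \<Longrightarrow> degree (euler_step s c q) \<le> Suc n"
  by (rule degree_le) (auto simp: coeff_euler_step coeff_eq_0)

text \<open>
  In the expansion of \<open>(x - 1)\<^sup>s q\<close> at infinity, \<open>coeff q n\<close> belongs to the highest
  possible power \<open>x\<^sup>s\<^sup>+\<^sup>n\<close>, on which \<open>\<theta> + c\<close> acts as the scalar \<open>s + n + c\<close>. This power
  never changes, since \<open>s\<close> decreases while the degree bound increases.
\<close>

lemma euler_steps_degree_coeff:
  assumes "degree q \<le> n"
  shows degree_euler_steps: "degree (euler_steps s cs q) \<le> n + length cs"
    and coeff_euler_steps: "coeff (euler_steps s cs q) (n + length cs) =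
      (\<Prod>c\<leftarrow>cs. s + of_nat n + c) * coeff q n"
  using assms
proof (induction cs arbitrary: s q n)
  case (Cons c cs)
  {
    case 1
    show ?case using Cons.IH(1)[OF degree_euler_step[OF 1], of "s - 1" s c] by simp
  next
    case 2
    have "coeff (euler_step s c q) (Suc n) = (s + of_nat n + c) * coeff q n"
      using 2 by (simp add: coeff_euler_step coeff_eq_0 algebra_simps)
    then show ?case using Cons.IH(2)[OF degree_euler_step[OF 2], of "s - 1" s c] by (simp add: algebra_simps)
  }
qed simp_all

section \<open>The Rodrigues polynomials and the contiguity operators\<close>

text \<open>
  The shifts \<open>n - a, \<dots>, 1 - a\<close> are the exponents of \<open>x\<close> successively brought down when
  \<open>x\<^sup>n\<^sup>-\<^sup>a\<close> times a function is differentiated \<open>n\<close> times.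
\<close>

fun block_shifts :: "nat \<Rightarrow> 'a::field \<Rightarrow> 'a list" where
  "block_shifts 0 a = []"
| "block_shifts (Suc n) a = (of_nat (Suc n) - a) # block_shifts n a"

lemma length_block_shifts [simp]: "length (block_shifts n a) = n"
  by (induction n) simp_all

lemma set_block_shifts: "c \<in> set (block_shifts n a) \<Longrightarrow> \<exists>j. c = of_nat j - a"
  by (induction n) (auto simp del: of_nat_Suc)

text \<open>
  Passing from \<open>s\<close> to \<open>s - 1\<close> shifts the window of consecutive factors by one, so the two
  products differ only in their extreme factors.
\<close>

lemma prod_block_shifts_shift:
  "(\<Prod>c\<leftarrow>block_shifts n a. s - 1 + c) * (s + of_nat n - a) = (\<Prod>c\<leftarrow>block_shifts n a. s + c) * (s - a)"
proof (induction n)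
  case (Suc n)
  define p q where "p = (\<Prod>c\<leftarrow>block_shifts n a. s - 1 + c)" and "q = (\<Prod>c\<leftarrow>block_shifts n a. s + c)"
  have "(s - 1 + (of_nat (Suc n) - a)) * p * (s + of_nat (Suc n) - a) =
      p * (s + of_nat n - a) * (s + of_nat (Suc n) - a)"
    by (simp add: algebra_simps)
  also have "p * (s + of_nat n - a) = q * (s - a)"
    unfolding p_def q_def by (rule Suc.IH)
  finally have "(s - 1 + (of_nat (Suc n) - a)) * p * (s + of_nat (Suc n) - a) =
      (s + (of_nat (Suc n) - a)) * q * (s - a)"
    by (simp add: algebra_simps)
  then show ?case
    unfolding p_def q_def by simp
qed simp

text \<open>
  The list of indices is an argument, so that single operators and segments of the Rodrigues
  product are covered.
\<close>

definition jp_shifts :: "nat \<Rightarrow> (nat \<Rightarrow> 'a::field) \<Rightarrow> (nat \<Rightarrow> nat) \<Rightarrow> nat list \<Rightarrow> 'a list" where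
  "jp_shifts r m l is =
     concat (map (\<lambda>i. block_shifts (part r l i - part r l (Suc i)) ((\<Sum>j=1..i. m j) + of_nat i)) is)"

text \<open>
  The Rodrigues expression without its outer factor is \<open>(x - 1)\<^sup>-\<^sup>k\<^sup>-\<^sup>1\<close> times this polynomial; the
  initial polynomial \<open>1\<close> stands for \<open>(x - 1)\<close> to the power \<open>l\<^sub>1 - k - 1\<close>. Its leading
  coefficient is \<open>jp_lead\<close>.
\<close>

definition jp_unnorm :: "nat \<Rightarrow> (nat \<Rightarrow> 'a::field) \<Rightarrow> (nat \<Rightarrow> nat) \<Rightarrow> 'a \<Rightarrow> 'a poly" where
  "jp_unnorm r m l k = euler_steps (of_nat (l 1) - k - 1) (jp_shifts r m l [1..<Suc r]) 1"

definition jp_lead :: "nat \<Rightarrow> (nat \<Rightarrow> 'a::field) \<Rightarrow> (nat \<Rightarrow> nat) \<Rightarrow> 'a \<Rightarrow> 'a" where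
  "jp_lead r m l k = (\<Prod>c\<leftarrow>jp_shifts r m l [1..<Suc r]. of_nat (l 1) - k - 1 + c)"

lemma jp_shifts_append: "jp_shifts r m l (is @ js) = jp_shifts r m l is @ jp_shifts r m l js"
  by (simp add: jp_shifts_def)

lemma part_antimono: "is_part r l \<Longrightarrow> 1 \<le> i \<Longrightarrow> part r l (Suc i) \<le> part r l i"
  by (auto simp: part_def is_part_def)

lemma length_jp_shifts:
  assumes "is_part r l" "r \<ge> 1"
  shows "length (jp_shifts r m l [1..<Suc r]) = l 1"
proof -
  have "length (jp_shifts r m l [1..<Suc n]) + part r l (Suc n) = l 1" for n
  proof (induction n)
    case 0
    show ?case using assms by (simp add: jp_shifts_def part_def)
  next
    case (Suc n)
    have "[1..<Suc (Suc n)] = [1..<Suc n] @ [Suc n]" by simp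
    then have "length (jp_shifts r m l [1..<Suc (Suc n)]) =
        length (jp_shifts r m l [1..<Suc n]) + (part r l (Suc n) - part r l (Suc (Suc n)))"
      by (simp only: jp_shifts_append length_append) (simp add: jp_shifts_def)
    then show ?case using Suc part_antimono[OF assms(1), of "Suc n"] by simp
  qed
  from this[of r] show ?thesis by (simp add: part_def)
qed

lemma is_part_add_ones: "is_part r l \<Longrightarrow> is_part r (add_ones l i)"
  by (fastforce simp: is_part_def add_ones_def)

lemma jp_unnorm_degree_coeff:
  assumes "is_part r l" "r \<ge> 1"
  shows degree_jp_unnorm_le: "degree (jp_unnorm r m l k) \<le> l 1"
    and coeff_jp_unnorm: "coeff (jp_unnorm r m l k) (l 1) = jp_lead r m l k"
  using euler_steps_degree_coeff[of 1 0 "of_nat (l 1) - k - 1" "jp_shifts r m l [1..<Suc r]"]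
  by (simp_all add: jp_unnorm_def jp_lead_def length_jp_shifts[OF assms] del: upt_Suc One_nat_def)

text \<open>
  The term \<open>-(k + 1)\<close> in \<open>D\<^sub>i\<close> is produced by conjugation with \<open>(x - 1)\<^sup>k\<^sup>+\<^sup>1\<close>:
  \<open>D\<^sub>i\<close> acts on \<open>q\<close> as \<open>\<theta> + k + 1 - e\<^sub>i\<close> acts on \<open>(x - 1)\<^sup>-\<^sup>k\<^sup>-\<^sup>1 q\<close>.
\<close>

lemma jp_D_euler_step: "jp_D r m l k i q = euler_step (- k - 1) (k + 1 - jp_e r m l k i) q"
  by (rule poly_eqI) (simp add: jp_D_def euler_step_def coeff_pCons algebra_simps split: nat.split)

text \<open>
  Raising the first \<open>i\<close> parts changes only the difference \<open>l\<^sub>i - l\<^sub>i\<^sub>+\<^sub>1\<close>, whose block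
  of shifts receives one new element at its head, namely the shift belonging to \<open>D\<^sub>i\<close>.
\<close>

lemma jp_shifts_add_ones:
  assumes "is_part r l" "1 \<le> i" "i \<le> r"
  obtains xs ys where "jp_shifts r m l [1..<Suc r] = xs @ ys"
    and "jp_shifts r m (add_ones l i) [1..<Suc r] = xs @ (k + 1 - jp_e r m l k i) # ys"
proof -
  let ?n = "part r l i - part r l (Suc i)" and ?l = "add_ones l i"
  let ?a = "(\<Sum>j=1..i. m j) + of_nat i"
  have upt: "[1..<Suc r] = [1..<i] @ [i] @ [Suc i..<Suc r]"
    using assms upt_add_eq_append[of 1 i "Suc r - i"] by (simp add: upt_conv_Cons del: upt_Suc)
  have "jp_shifts r m ?l [1..<i] = jp_shifts r m l [1..<i]"
    unfolding jp_shifts_def using assms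
    by (intro arg_cong[of _ _ concat] map_cong refl arg_cong2[of _ _ _ _ block_shifts]) (auto simp: part_def add_ones_def)
  moreover have "jp_shifts r m ?l [Suc i..<Suc r] = jp_shifts r m l [Suc i..<Suc r]"
    unfolding jp_shifts_def
    by (intro arg_cong[of _ _ concat] map_cong refl arg_cong2[of _ _ _ _ block_shifts]) (auto simp: part_def add_ones_def)
  moreover have "jp_shifts r m ?l [i] = (of_nat (Suc ?n) - ?a) # jp_shifts r m l [i]"
  proof -
    have "part r ?l i - part r ?l (Suc i) = Suc ?n"
      using assms part_antimono[OF assms(1,2)] by (auto simp: part_def add_ones_def)
    then show ?thesis by (simp add: jp_shifts_def)
  qed
  moreover have "of_nat (Suc ?n) - ?a = k + 1 - jp_e r m l k i"
    using assms part_antimono[OF assms(1,2)] by (simp add: jp_e_def part_ext_def of_nat_diff)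
  ultimately show ?thesis
    using that[of "jp_shifts r m l [1..<i]" "jp_shifts r m l [i] @ jp_shifts r m l [Suc i..<Suc r]"]
    unfolding upt jp_shifts_append by (simp del: upt_Suc One_nat_def of_nat_Suc)
qed

text \<open>
  The exponent \<open>l\<^sub>1 - k - 1\<close> is the same on both sides, as \<open>l\<^sub>1\<close> and \<open>k\<close> grow by one
  together; only the list of shifts differs.
\<close>

lemma jp_D_jp_unnorm_raise:
  assumes "is_part r l" "1 \<le> i" "i \<le> r"
  shows "jp_D r m l k i (jp_unnorm r m l k) = jp_unnorm r m (add_ones l i) (k + 1)"
proof -
  obtain xs ys where xy: "jp_shifts r m l [1..<Suc r] = xs @ ys"
    "jp_shifts r m (add_ones l i) [1..<Suc r] = xs @ (k + 1 - jp_e r m l k i) # ys"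
    using jp_shifts_add_ones[OF assms] by metis
  have len: "length (xs @ ys) = l 1"
    using length_jp_shifts[of r l m] assms xy(1) by simp
  have "of_nat (add_ones l i 1) - (k + 1) - 1 = of_nat (l 1) - k - 1"
    using assms by (simp add: add_ones_def)
  then show ?thesis
    unfolding jp_unnorm_def xy euler_steps_insert len jp_D_euler_step by simp
qed

text \<open>
  The shift belonging to \<open>D\<^sub>0\<close> is \<open>-s\<close> with \<open>s = l\<^sub>1 - k - 1\<close>. Applied first instead of last,
  it sends \<open>(x - 1)\<^sup>s\<close> to \<open>s (x - 1)\<^sup>s\<^sup>-\<^sup>1\<close>.
\<close>

lemma jp_D_jp_unnorm_0:
  assumes "is_part r l" "1 \<le> r"
  shows "jp_D r m l k 0 (jp_unnorm r m l k) =
    smult (of_nat (l 1) - k - 1) (jp_unnorm r m (add_ones l 0) (k + 1))"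
proof -
  let ?cs = "jp_shifts r m l [1..<Suc r]" and ?s = "of_nat (l 1) - k - 1"
  have "add_ones l 0 = l" by (auto simp: add_ones_def)
  have e0: "k + 1 - jp_e r m l k 0 = - ?s"
    using assms by (simp add: jp_e_def part_ext_def part_def)
  have "jp_D r m l k 0 (jp_unnorm r m l k) = euler_steps (?s - 1) ?cs (euler_step ?s (- ?s) 1)"
    unfolding jp_D_euler_step e0 euler_steps_move length_jp_shifts[OF assms]
    by (simp add: jp_unnorm_def)
  also have "euler_step ?s (- ?s) 1 = smult ?s 1"
    by (simp add: euler_step_def pderiv_1)
  finally have "jp_D r m l k 0 (jp_unnorm r m l k) = smult ?s (euler_steps (?s - 1) ?cs 1)"
    by (simp only: euler_steps_smult)
  moreover have "?s - 1 = of_nat (l 1) - (k + 1) - 1"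
    by simp
  ultimately show ?thesis
    by (simp only: jp_unnorm_def \<open>add_ones l 0 = l\<close>)
qed

text \<open>
  Every factor of the leading coefficient is an integer minus \<open>k + m\<^sub>1 + \<dots> + m\<^sub>i\<close> for some
  \<open>i\<close>, so this excludes zeros; moreover the condition is invariant under \<open>k \<mapsto> k + 1\<close>.
\<close>

definition generic_params :: "nat \<Rightarrow> (nat \<Rightarrow> 'a::field) \<Rightarrow> 'a \<Rightarrow> bool" where
  "generic_params r m k \<longleftrightarrow> (\<forall>i\<in>{1..r}. \<forall>z. k + (\<Sum>j=1..i. m j) \<noteq> of_int z)"

lemma generic_params_Suc: "generic_params r m k \<Longrightarrow> generic_params r m (k + 1)"
  unfolding generic_params_def
proof (intro ballI allI notI)
  fix i z assume g: "\<forall>i\<in>{1..r}. \<forall>z. k + (\<Sum>j=1..i. m j) \<noteq> of_int z" "i \<in> {1..r}"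
    "k + 1 + (\<Sum>j=1..i. m j) = of_int z"
  have "k + (\<Sum>j=1..i. m j) = of_int (z - 1)" using g(3) by (simp add: algebra_simps)
  then show False using g(1,2) by blast
qed

lemma generic_params_shift:
  assumes "generic_params r m k" "1 \<le> i" "i \<le> r"
  shows "of_nat p - k - 1 + (of_nat j - ((\<Sum>j=1..i. m j) + of_nat i)) \<noteq> 0"
proof
  assume "of_nat p - k - 1 + (of_nat j - ((\<Sum>j=1..i. m j) + of_nat i)) = 0"
  then have "k + (\<Sum>j=1..i. m j) = of_int (int p - 1 + int j - int i)"
    by (simp add: algebra_simps)
  then show False using assms unfolding generic_params_def by (metis atLeastAtMost_iff)
qed

lemma jp_lead_nonzero:
  assumes "generic_params r m k"
  shows "jp_lead r m l k \<noteq> 0"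
proof -
  have "of_nat (l 1) - k - 1 + c \<noteq> 0" if mem: "c \<in> set (jp_shifts r m l [1..<Suc r])" for c
  proof -
    obtain i where i: "i \<in> set [1..<Suc r]"
      "c \<in> set (block_shifts (part r l i - part r l (Suc i)) ((\<Sum>j=1..i. m j) + of_nat i))"
      using mem unfolding jp_shifts_def set_concat set_map by blast
    obtain j where c: "c = of_nat j - ((\<Sum>j=1..i. m j) + of_nat i)"
      using set_block_shifts[OF i(2)] by blast
    have "1 \<le> i" "i \<le> r" using i(1) by auto
    then show ?thesis unfolding c by (rule generic_params_shift[OF assms])
  qed
  then show ?thesis
    by (auto simp: jp_lead_def prod_list_zero_iff simp del: upt_Suc One_nat_def)
qed

text \<open>
  Each block contributes one telescoped quotient, which is the factor of the product in
  \<open>jp_A\<close> with the same index. The factor with index \<open>0\<close> has denominator \<open>1\<close> and equals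
  \<open>-(l\<^sub>1 - k - 1)\<close>.
\<close>

lemma jp_lead_Suc:
  assumes "generic_params r m k" "r \<ge> 1" "is_part r l"
  shows "(of_nat (l 1) - k - 1) * jp_lead r m l (k + 1) = jp_A r m l k 0 * jp_lead r m l k"
proof -
  let ?s = "of_nat (l 1) - k - 1"
  let ?a = "\<lambda>i. (\<Sum>j=1..i. m j) + of_nat i" and ?n = "\<lambda>i. part r l i - part r l (Suc i)"
  let ?f = "\<lambda>i. (k + (\<Sum>j=1..i. m j) - part_ext r l k 1 + of_nat i + 1) /
            (k + (\<Sum>j=1..i. m j) - part_ext r l k 1 + of_nat i + 1
               + part_ext r l k (Suc i) - part_ext r l k i)"
  have block: "(\<Prod>c\<leftarrow>block_shifts (?n i) (?a i). ?s - 1 + c) =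
      ?f i * (\<Prod>c\<leftarrow>block_shifts (?n i) (?a i). ?s + c)" if "1 \<le> i" "i \<le> r" for i
  proof -
    have ne: "?s + of_nat (?n i) - ?a i \<noteq> 0"
      using generic_params_shift[OF assms(1) that, of "l 1" "?n i"] by (simp add: algebra_simps)
    have "?f i = - (?s - ?a i) / - (?s + of_nat (?n i) - ?a i)"
      using that assms part_antimono[OF assms(3) that(1)]
      by (intro arg_cong2[of _ _ _ _ "(/)"]) (auto simp: part_ext_def of_nat_diff part_def)
    also have "\<dots> = (?s - ?a i) / (?s + of_nat (?n i) - ?a i)"
      by (rule minus_divide_divide)
    finally have f: "?f i = (?s - ?a i) / (?s + of_nat (?n i) - ?a i)" .
    have solve: "p = u / w * q" if "p * w = q * u" "w \<noteq> 0" for p q u w :: 'a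
      using that by (simp add: field_simps)
    show ?thesis
      unfolding f by (rule solve[OF prod_block_shifts_shift ne])
  qed
  have lead: "jp_lead r m l k' = (\<Prod>i\<in>{1..r}. \<Prod>c\<leftarrow>block_shifts (?n i) (?a i). of_nat (l 1) - k' - 1 + c)" for k'
  proof -
    have concat: "(\<Prod>c\<leftarrow>jp_shifts r m l is. f c) = (\<Prod>i\<leftarrow>is. \<Prod>c\<leftarrow>block_shifts (?n i) (?a i). f c)" for f "is"
      by (induction "is") (simp_all add: jp_shifts_def)
    have upt: "(\<Prod>i\<leftarrow>[1..<Suc r]. g i) = (\<Prod>i\<in>{1..r}. g i)" for g :: "nat \<Rightarrow> 'a"
      using prod.distinct_set_conv_list[of "[1..<Suc r]" g]
      by (simp add: atLeastLessThanSuc_atLeastAtMost del: upt_Suc)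
    show ?thesis
      unfolding jp_lead_def concat upt ..
  qed
  have s_pred: "of_nat (l 1) - (k + 1) - 1 = ?s - 1"
    by simp
  have "jp_lead r m l (k + 1) = (\<Prod>i\<in>{1..r}. ?f i * (\<Prod>c\<leftarrow>block_shifts (?n i) (?a i). ?s + c))"
    unfolding lead s_pred by (intro prod.cong refl block) auto
  also have "\<dots> = (\<Prod>i\<in>{1..r}. ?f i) * jp_lead r m l k"
    unfolding lead prod.distrib ..
  finally have "?s * jp_lead r m l (k + 1) = ?s * (\<Prod>i\<in>{1..r}. ?f i) * jp_lead r m l k"
    by (simp add: mult.assoc)
  moreover have "jp_A r m l k 0 = ?s * (\<Prod>i\<in>{1..r}. ?f i)"
  proof -
    have "(\<Prod>i=0..r. ?f i) = ?f 0 * (\<Prod>i\<in>{1..r}. ?f i)"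
      by (simp add: prod.atLeast_Suc_atMost)
    moreover have "?f 0 = - ?s"
      using assms by (simp add: part_ext_def part_def)
    ultimately have "(\<Prod>i=0..r. ?f i) = - (?s * (\<Prod>i\<in>{1..r}. ?f i))"
      by (simp only: mult_minus_left)
    moreover have "jp_A r m l k 0 = - (\<Prod>i=0..r. ?f i)"
      by (simp only: jp_A_def simp_thms if_True)
    ultimately show ?thesis by (simp only: minus_minus)
  qed
  ultimately show ?thesis by simp
qed

definition jp_monic :: "nat \<Rightarrow> (nat \<Rightarrow> 'a::field) \<Rightarrow> (nat \<Rightarrow> nat) \<Rightarrow> 'a \<Rightarrow> 'a poly" where
  "jp_monic r m l k = smult (inverse (jp_lead r m l k)) (jp_unnorm r m l k)"

text \<open>
  For \<open>i \<ge> 1\<close> the ratio of leading coefficients is read off from \<open>D\<^sub>i\<close>, which multiplies the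
  leading coefficient of a polynomial of degree \<open>l\<^sub>1 = e\<^sub>0\<close> by \<open>e\<^sub>0 - e\<^sub>i\<close>.
\<close>

lemma jp_D_jp_monic:
  assumes "generic_params r m k" "r \<ge> 1" "is_part r l" "i \<le> r"
  shows "jp_D r m l k i (jp_monic r m l k) = smult (jp_A r m l k i) (jp_monic r m (add_ones l i) (k + 1))"
proof -
  let ?L = "jp_lead r m l k" and ?L' = "jp_lead r m (add_ones l i) (k + 1)"
  have nz: "?L \<noteq> 0" "?L' \<noteq> 0"
    using assms generic_params_Suc jp_lead_nonzero by blast+
  have D: "jp_D r m l k i (jp_monic r m l k) = smult (inverse ?L) (jp_D r m l k i (jp_unnorm r m l k))"
    unfolding jp_D_euler_step jp_monic_def
    using euler_steps_smult[of "- k - 1" "[k + 1 - jp_e r m l k i]"] by simp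
  show ?thesis
  proof (cases "i = 0")
    case True
    have l: "add_ones l 0 = l" by (auto simp: add_ones_def)
    have "inverse ?L * (of_nat (l 1) - k - 1) = inverse ?L * ((of_nat (l 1) - k - 1) * ?L') * inverse ?L'"
      using nz by simp
    also have "(of_nat (l 1) - k - 1) * ?L' = jp_A r m l k 0 * ?L"
      unfolding True l by (rule jp_lead_Suc[OF assms(1-3)])
    finally have "inverse ?L * (of_nat (l 1) - k - 1) = jp_A r m l k 0 * inverse ?L'"
      using nz by simp
    then show ?thesis
      unfolding D unfolding True jp_D_jp_unnorm_0[OF assms(3,2)] by (simp add: jp_monic_def)
  next
    case False
    let ?e = "jp_e r m l k i"
    have i: "1 \<le> i" using False by simp
    have "?L' = coeff (jp_D r m l k i (jp_unnorm r m l k)) (Suc (l 1))"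
      using coeff_jp_unnorm[OF is_part_add_ones[OF assms(3)] assms(2), of m i "k + 1"] i
      by (simp add: jp_D_jp_unnorm_raise[OF assms(3) i assms(4)] add_ones_def)
    also have "\<dots> = (of_nat (l 1) - ?e) * ?L"
      unfolding jp_D_euler_step
      using degree_jp_unnorm_le[OF assms(3,2), of m k]
      by (simp add: coeff_euler_step coeff_eq_0 coeff_jp_unnorm[OF assms(3,2)] del: One_nat_def)
    also have "of_nat (l 1) - ?e = jp_A r m l k i"
      using False assms by (simp add: jp_A_def jp_e_def part_ext_def part_def)
    finally have "jp_A r m l k i * inverse ?L' = inverse ?L"
      using nz by (simp add: field_simps)
    then show ?thesis
      unfolding D jp_D_jp_unnorm_raise[OF assms(3) i assms(4)] by (simp add: jp_monic_def)
  qed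
qed

section \<open>The Rodrigues expression on the cut plane\<close>

lemma open_cut_plane: "open cut_plane"
proof -
  have "complex_of_real ` {..1} = {z. Re z \<le> 1} \<inter> \<real>"
    by (auto simp: complex_is_Real_iff complex_eq_iff image_iff)
  then have "closed (complex_of_real ` {..1})"
    by (simp add: closed_Int closed_halfspace_Re_le closed_complex_Reals)
  then show ?thesis
    by (simp add: cut_plane_def open_Compl)
qed

lemma cut_planeD:
  assumes "x \<in> cut_plane"
  shows "x \<notin> \<real>\<^sub>\<le>\<^sub>0" "x - 1 \<notin> \<real>\<^sub>\<le>\<^sub>0"
proof -
  have "Re x > 1" if "Im x = 0"
    using assms that by (force simp: cut_plane_def image_iff complex_eq_iff)
  then show "x \<notin> \<real>\<^sub>\<le>\<^sub>0" "x - 1 \<notin> \<real>\<^sub>\<le>\<^sub>0"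
    by (auto simp: complex_nonpos_Reals_iff)
qed

lemma infinite_cut_plane: "infinite cut_plane"
proof -
  have "2 \<in> cut_plane"
    by (auto simp: cut_plane_def complex_eq_iff)
  then show ?thesis
    using open_cut_plane finite_imp_not_open by blast
qed

text \<open>
  Up to a factor \<open>x\<^sup>b\<^sup>-\<^sup>1\<close>, differentiating \<open>x\<^sup>b f\<close> amounts to applying \<open>\<theta> + b\<close> to
  \<open>f\<close>. The function is known on the cut plane only, which suffices as this is open.
\<close>

lemma deriv_powr_euler_step:
  assumes g: "\<And>y. y \<in> cut_plane \<Longrightarrow> g y = y powr b * ((y - 1) powr s * poly q y)"
    and x: "x \<in> cut_plane"
  shows "deriv g x = x powr (b - 1) * ((x - 1) powr (s - 1) * poly (euler_step s b q) x)"
proof -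
  note cut = cut_planeD[OF x]
  have nz: "x \<noteq> 0" "x - 1 \<noteq> 0" using cut by auto
  have eq: "x powr b = x powr (b - 1) * x" "(x - 1) powr s = (x - 1) powr (s - 1) * (x - 1)"
    using nz powr_add[of x "b - 1" 1] powr_add[of "x - 1" "s - 1" 1] by simp_all
  have d1: "((\<lambda>y. (y - 1) powr s) has_field_derivative s * (x - 1) powr (s - 1)) (at x)"
  proof -
    have "((\<lambda>y. y - 1) has_field_derivative 1) (at x)"
      by (auto intro!: derivative_eq_intros)
    from DERIV_chain2[OF has_field_derivative_powr[OF cut(2), of s] this] show ?thesis
      by simp
  qed
  have "((\<lambda>y. y powr b * ((y - 1) powr s * poly q y)) has_field_derivative
      b * x powr (b - 1) * ((x - 1) powr s * poly q x) +
      (s * (x - 1) powr (s - 1) * poly q x + poly (pderiv q) x * (x - 1) powr s) * x powr b) (at x)"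
    by (intro DERIV_mult has_field_derivative_powr[OF cut(1)] d1 poly_DERIV)
  then have "(g has_field_derivative
      b * x powr (b - 1) * ((x - 1) powr s * poly q x) +
      (s * (x - 1) powr (s - 1) * poly q x + poly (pderiv q) x * (x - 1) powr s) * x powr b) (at x)"
    by (rule has_field_derivative_transform_within_open[OF _ open_cut_plane x]) (simp add: g)
  then have "deriv g x = b * x powr (b - 1) * ((x - 1) powr s * poly q x) +
      (s * (x - 1) powr (s - 1) * poly q x + poly (pderiv q) x * (x - 1) powr s) * x powr b"
    by (rule DERIV_imp_deriv)
  also have "\<dots> = x powr (b - 1) * ((x - 1) powr (s - 1) * poly (euler_step s b q) x)"
    unfolding eq by (simp add: euler_step_def algebra_simps)
  finally show ?thesis .
qed

lemma higher_deriv_powr_euler_steps: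
  assumes g: "\<And>y. y \<in> cut_plane \<Longrightarrow> g y = y powr (of_nat n - a) * ((y - 1) powr s * poly q y)"
    and x: "x \<in> cut_plane"
  shows "(deriv ^^ n) g x =
    x powr (- a) * ((x - 1) powr (s - of_nat n) * poly (euler_steps s (block_shifts n a) q) x)"
  using g
proof (induction n arbitrary: g s q)
  case 0
  then show ?case using x by simp
next
  case (Suc n)
  let ?q = "euler_step s (of_nat (Suc n) - a) q"
  have "deriv g y = y powr (of_nat n - a) * ((y - 1) powr (s - 1) * poly ?q y)" if "y \<in> cut_plane" for y
    using deriv_powr_euler_step[OF Suc.prems that] by simp
  from Suc.IH[OF this] show ?case
    by (simp add: funpow_Suc_right diff_diff_eq del: funpow.simps)
qed

lemma Dtilde_euler_steps:
  assumes f: "\<And>y. y \<in> cut_plane \<Longrightarrow> f y = (y - 1) powr s * poly q y" and x: "x \<in> cut_plane"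
  shows "Dtilde r m l i f x =
    (x - 1) powr (s - of_nat (length (jp_shifts r m l [i]))) * poly (euler_steps s (jp_shifts r m l [i]) q) x"
proof -
  define n where "n = part r l i - part r l (Suc i)"
  define a where "a = (\<Sum>j=1..i. m j) + of_nat i"
  have "x \<noteq> 0" using cut_planeD(1)[OF x] by auto
  then have "x powr a * x powr (- a) = 1"
    by (simp flip: powr_add)
  moreover have "(deriv ^^ n) (\<lambda>y. y powr (of_nat n - a) * f y) x =
      x powr (- a) * ((x - 1) powr (s - of_nat n) * poly (euler_steps s (block_shifts n a) q) x)"
    by (rule higher_deriv_powr_euler_steps[OF _ x]) (simp add: f)
  ultimately show ?thesis
    unfolding Dtilde_def Let_def n_def[symmetric] a_def[symmetric]
    by (simp add: jp_shifts_def del: One_nat_def flip: n_def a_def mult.assoc)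
qed

lemma fold_Dtilde_euler_steps:
  assumes f: "\<And>y. y \<in> cut_plane \<Longrightarrow> f y = (y - 1) powr s * poly q y" and x: "x \<in> cut_plane"
  shows "fold (Dtilde r m l) is f x =
    (x - 1) powr (s - of_nat (length (jp_shifts r m l is))) * poly (euler_steps s (jp_shifts r m l is) q) x"
  using f
proof (induction "is" arbitrary: f s q)
  case Nil
  then show ?case using x by (simp add: jp_shifts_def)
next
  case (Cons i "is")
  have split: "jp_shifts r m l (i # is) = jp_shifts r m l [i] @ jp_shifts r m l is"
    using jp_shifts_append[of r m l "[i]" "is"] by simp
  show ?case
    using Cons.IH[OF Dtilde_euler_steps[OF Cons.prems, of _ r m l i]]
    by (simp add: split euler_steps_append diff_diff_eq)
qed

text \<open>
  The \<open>l\<^sub>1\<close> differentiations lower the exponent of \<open>x - 1\<close> from \<open>l\<^sub>1 - k - 1\<close> to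
  \<open>-k - 1\<close>, and the outer power in the Rodrigues expression cancels what is left.
\<close>

lemma rodrigues_eq_jp_unnorm:
  assumes "is_part r l" "r \<ge> 1" "x \<in> cut_plane"
  shows "rodrigues r m l k x = poly (jp_unnorm r m l k) x"
proof -
  let ?s = "of_nat (l 1) - k - 1"
  have "fold (Dtilde r m l) [1..<Suc r] (\<lambda>y. (y - 1) powr ?s) x =
      (x - 1) powr (?s - of_nat (l 1)) * poly (jp_unnorm r m l k) x"
    using fold_Dtilde_euler_steps[of "\<lambda>y. (y - 1) powr ?s" ?s 1 x r m l "[1..<Suc r]"] assms
    by (simp add: jp_unnorm_def length_jp_shifts del: upt_Suc One_nat_def)
  moreover have "x - 1 \<noteq> 0"
    using cut_planeD(2)[OF assms(3)] by auto
  then have "(x - 1) powr (k + 1) * (x - 1) powr (?s - of_nat (l 1)) = 1"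
    by (simp flip: powr_add)
  ultimately show ?thesis
    unfolding rodrigues_def by (simp del: upt_Suc flip: mult.assoc)
qed

section \<open>Specialization of the parameters\<close>

definition monomial_value :: "(nat \<Rightarrow> complex) \<Rightarrow> (nat \<Rightarrow>\<^sub>0 nat) \<Rightarrow> complex" where
  "monomial_value v \<alpha> = (\<Prod>j\<in>Poly_Mapping.keys \<alpha>. v j ^ Poly_Mapping.lookup \<alpha> j)"

lemma monomial_value_superset:
  assumes "finite S" "Poly_Mapping.keys \<alpha> \<subseteq> S"
  shows "monomial_value v \<alpha> = (\<Prod>j\<in>S. v j ^ Poly_Mapping.lookup \<alpha> j)"
  unfolding monomial_value_def
  by (rule prod.mono_neutral_left) (use assms in \<open>auto simp: in_keys_iff\<close>)

lemma monomial_value_add: "monomial_value v (\<alpha> + \<beta>) = monomial_value v \<alpha> * monomial_value v \<beta>"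
proof -
  let ?S = "Poly_Mapping.keys \<alpha> \<union> Poly_Mapping.keys \<beta>"
  have "monomial_value v (\<alpha> + \<beta>) = (\<Prod>j\<in>?S. v j ^ Poly_Mapping.lookup (\<alpha> + \<beta>) j)"
    by (rule monomial_value_superset) (use keys_add[of \<alpha> \<beta>] in auto)
  also have "\<dots> = monomial_value v \<alpha> * monomial_value v \<beta>"
    by (simp add: lookup_add power_add prod.distrib monomial_value_superset[of ?S])
  finally show ?thesis .
qed

lemma param_poly_eval_alt:
  "param_poly_eval v p =
     (\<Sum>\<alpha>\<in>Poly_Mapping.keys p. of_rat (Poly_Mapping.lookup p \<alpha>) * monomial_value v \<alpha>)"
  by (simp add: param_poly_eval_def monomial_value_def)

lemma param_poly_eval_0 [simp]: "param_poly_eval v 0 = 0"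
  by (simp add: param_poly_eval_alt)

lemma param_poly_eval_single [simp]:
  "param_poly_eval v (Poly_Mapping.single \<alpha> c) = of_rat c * monomial_value v \<alpha>"
  by (cases "c = 0") (auto simp: param_poly_eval_alt)

lemma param_poly_eval_1 [simp]: "param_poly_eval v 1 = 1"
  using param_poly_eval_single[of v 0 1] by (simp add: monomial_value_def del: param_poly_eval_single)

lemma param_poly_eval_add [simp]:
  "param_poly_eval v (p + q) = param_poly_eval v p + param_poly_eval v q"
  unfolding param_poly_eval_alt
  by (rule setsum_keys_plus_distrib) (auto simp: of_rat_add ring_distribs)

lemma param_poly_single_induct [case_names single add]:
  assumes "\<And>\<alpha> c. P (Poly_Mapping.single \<alpha> (c :: rat))"
    and "\<And>p q. P p \<Longrightarrow> P q \<Longrightarrow> P (p + q)"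
  shows "P (p :: param_poly)"
proof (induction p rule: update_induct)
  case const
  then show ?case using assms(1)[of 0 0] by simp
next
  case (update p \<alpha> c)
  then have "Poly_Mapping.update \<alpha> c p = p + Poly_Mapping.single \<alpha> c"
    by (intro poly_mapping_eqI) (auto simp: lookup_update lookup_add lookup_single in_keys_iff)
  then show ?case using assms update by simp
qed

lemma param_poly_eval_mult [simp]:
  "param_poly_eval v (p * q) = param_poly_eval v p * param_poly_eval v q"
proof (induction p rule: param_poly_single_induct)
  case (single \<alpha> c)
  show ?case
    by (induction q rule: param_poly_single_induct)
      (simp_all add: mult_single of_rat_mult monomial_value_add ring_distribs)
qed (simp add: ring_distribs)

lemma param_poly_eval_uminus [simp]: "param_poly_eval v (- p) = - param_poly_eval v p"
  using param_poly_eval_add[of v p "- p"] by (simp add: eq_neg_iff_add_eq_0 add.commute)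

lemma param_poly_eval_prod [simp]:
  "param_poly_eval v (\<Prod>x\<in>S. f x) = (\<Prod>x\<in>S. param_poly_eval v (f x))"
  by (induction S rule: infinite_finite_induct) auto

lemma digits_inject:
  fixes f g :: "nat \<Rightarrow> nat"
  assumes "\<And>j. j < n \<Longrightarrow> f j < B" "\<And>j. j < n \<Longrightarrow> g j < B"
    and "(\<Sum>j<n. f j * B ^ j) = (\<Sum>j<n. g j * B ^ j)" and "j < n"
  shows "f j = g j"
  using assms
proof (induction n arbitrary: f g j)
  case (Suc n)
  have split: "(\<Sum>j<Suc n. h j * B ^ j) = h 0 + B * (\<Sum>j<n. h (Suc j) * B ^ j)" for h :: "nat \<Rightarrow> nat"
    by (subst sum.lessThan_Suc_shift) (simp add: sum_distrib_left algebra_simps)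
  have eq: "f 0 + B * (\<Sum>j<n. f (Suc j) * B ^ j) = g 0 + B * (\<Sum>j<n. g (Suc j) * B ^ j)"
    using Suc.prems(3) by (simp only: split)
  have less: "f 0 < B" "g 0 < B"
    using Suc.prems by auto
  have "f 0 = g 0"
    using arg_cong[OF eq, of "\<lambda>x. x mod B"] less by simp
  moreover have "f (Suc j) = g (Suc j)" if "j < n" for j
    using Suc.IH[of "\<lambda>j. f (Suc j)" "\<lambda>j. g (Suc j)" j] Suc.prems eq less that \<open>f 0 = g 0\<close> by auto
  ultimately show ?case
    using Suc.prems(4) by (cases j) auto
qed simp

text \<open>
  Kronecker substitution: replacing the \<open>j\<close>-th indeterminate by \<open>t\<close> to the power \<open>B\<^sup>j\<close>, with
  \<open>B\<close> larger than all exponents, keeps the monomials distinct, so a nonzero polynomial becomes a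
  nonzero univariate polynomial in \<open>t\<close>.
\<close>

lemma param_poly_nonvanishing:
  assumes "p \<noteq> 0"
  obtains v where "param_poly_eval v p \<noteq> 0"
proof -
  let ?K = "Poly_Mapping.keys p"
  have "finite (\<Union>\<alpha>\<in>?K. Poly_Mapping.keys \<alpha>)"
    by auto
  then obtain n where n: "\<And>\<alpha> j. \<alpha> \<in> ?K \<Longrightarrow> j \<in> Poly_Mapping.keys \<alpha> \<Longrightarrow> j < n"
    unfolding finite_nat_set_iff_bounded by blast
  have "finite (\<Union>\<alpha>\<in>?K. Poly_Mapping.lookup \<alpha> ` Poly_Mapping.keys \<alpha>)"
    by auto
  then obtain B0 where B0: "\<And>\<alpha> j. \<alpha> \<in> ?K \<Longrightarrow> j \<in> Poly_Mapping.keys \<alpha> \<Longrightarrow> Poly_Mapping.lookup \<alpha> j < B0"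
    unfolding finite_nat_set_iff_bounded by blast
  define B where "B = Suc B0"
  have B: "Poly_Mapping.lookup \<alpha> j < B" if "\<alpha> \<in> ?K" for \<alpha> j
    using B0[OF that, of j] by (cases "j \<in> Poly_Mapping.keys \<alpha>") (auto simp: B_def in_keys_iff)
  define w where "w = (\<lambda>\<alpha>. \<Sum>j<n. Poly_Mapping.lookup \<alpha> j * B ^ j)"
  have w_inj: "inj_on w ?K"
  proof (rule inj_onI)
    fix \<alpha> \<beta> assume ab: "\<alpha> \<in> ?K" "\<beta> \<in> ?K" "w \<alpha> = w \<beta>"
    show "\<alpha> = \<beta>"
    proof (rule poly_mapping_eqI)
      fix j show "Poly_Mapping.lookup \<alpha> j = Poly_Mapping.lookup \<beta> j"
      proof (cases "j < n")
        case True
        then show ?thesis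
          using ab B
          by (intro digits_inject[of n "Poly_Mapping.lookup \<alpha>" B "Poly_Mapping.lookup \<beta>" j]) (simp_all add: w_def)
      next
        case False
        then show ?thesis using ab n[of _ j] by (metis in_keys_iff)
      qed
    qed
  qed
  define u :: "complex poly" where
    "u = (\<Sum>\<alpha>\<in>?K. monom (of_rat (Poly_Mapping.lookup p \<alpha>)) (w \<alpha>))"
  have eval: "param_poly_eval (\<lambda>j. t ^ (B ^ j)) p = poly u t" for t
  proof -
    have "monomial_value (\<lambda>j. t ^ (B ^ j)) \<alpha> = t ^ w \<alpha>" if "\<alpha> \<in> ?K" for \<alpha>
      using n[OF that]
      by (subst monomial_value_superset[of "{..<n}"])
        (auto simp: w_def power_sum mult.commute simp flip: power_mult)
    then show ?thesis
      by (simp add: param_poly_eval_alt u_def poly_sum poly_monom)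
  qed
  obtain \<alpha> where \<alpha>: "\<alpha> \<in> ?K"
    using assms by (metis keys_eq_empty ex_in_conv)
  have "coeff u (w \<alpha>) = (\<Sum>\<beta>\<in>?K. if \<beta> = \<alpha> then of_rat (Poly_Mapping.lookup p \<alpha>) else 0)"
    unfolding u_def coeff_sum
    by (rule sum.cong) (use w_inj \<alpha> in \<open>auto simp: inj_on_def\<close>)
  also have "\<dots> \<noteq> 0"
    using \<alpha> by (simp add: in_keys_iff)
  finally have "u \<noteq> 0" by auto
  then have "finite {t. poly u t = 0}"
    by (rule poly_roots_finite)
  then obtain t where "poly u t \<noteq> 0"
    using infinite_UNIV_char_0[where 'a = complex] by (metis (mono_tags) ex_new_if_finite mem_Collect_eq)
  then show ?thesis using that eval by metis
qed

lemma ratfun_eval_Fract: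
  assumes "param_poly_eval v b \<noteq> 0"
  shows "ratfun_eval v (Fract a b) = param_poly_eval v a / param_poly_eval v b"
  unfolding ratfun_eval_def
proof (rule the_equality)
  fix y assume "\<exists>c d. Fract a b = Fract c d \<and> param_poly_eval v d \<noteq> 0 \<and>
    y = param_poly_eval v c / param_poly_eval v d"
  then obtain c d where cd: "Fract a b = Fract c d" "param_poly_eval v d \<noteq> 0"
    "y = param_poly_eval v c / param_poly_eval v d" by auto
  have "b \<noteq> 0" "d \<noteq> 0" using assms cd by auto
  then have "a * d = c * b" using cd by (simp add: eq_fract)
  then have "param_poly_eval v a * param_poly_eval v d = param_poly_eval v c * param_poly_eval v b"
    by (metis param_poly_eval_mult)
  then show "y = param_poly_eval v a / param_poly_eval v b"
    using assms cd(2,3) by (metis nonzero_eq_divide_eq nonzero_divide_eq_eq mult.commute frac_eq_eq)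
qed (use assms in auto)

lemma regular_atE:
  assumes "regular_at v f"
  obtains a b where "f = Fract a b" "b \<noteq> 0" "param_poly_eval v b \<noteq> 0"
    "ratfun_eval v f = param_poly_eval v a / param_poly_eval v b"
  using assms ratfun_eval_Fract unfolding regular_at_def by (metis param_poly_eval_0)

lemma regular_eval_Fract1:
  "regular_at v (Fract a 1)" "ratfun_eval v (Fract a 1) = param_poly_eval v a"
  unfolding regular_at_def using ratfun_eval_Fract[of v 1 a] by (simp, metis param_poly_eval_1 zero_neq_one)
    (use ratfun_eval_Fract[of v 1 a] in simp)

lemma regular_eval_param [simp]: "regular_at v (param j)" "ratfun_eval v (param j) = v j"
  by (simp_all add: param_def regular_eval_Fract1 monomial_value_def)

lemma regular_eval_0 [simp]: "regular_at v 0" "ratfun_eval v 0 = 0"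
  by (simp_all add: Zero_fract_def regular_eval_Fract1)

lemma regular_eval_1 [simp]: "regular_at v 1" "ratfun_eval v 1 = 1"
  by (simp_all add: One_fract_def regular_eval_Fract1)

lemma regular_eval_add:
  assumes "regular_at v f" "regular_at v g"
  shows regular_add [simp]: "regular_at v (f + g)"
    and ratfun_eval_add [simp]: "ratfun_eval v (f + g) = ratfun_eval v f + ratfun_eval v g"
proof -
  obtain a b where f: "f = Fract a b" "b \<noteq> 0" "param_poly_eval v b \<noteq> 0"
    "ratfun_eval v f = param_poly_eval v a / param_poly_eval v b"
    using assms(1) by (rule regular_atE)
  obtain c d where g: "g = Fract c d" "d \<noteq> 0" "param_poly_eval v d \<noteq> 0"
    "ratfun_eval v g = param_poly_eval v c / param_poly_eval v d"
    using assms(2) by (rule regular_atE)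
  have fg: "f + g = Fract (a * d + c * b) (b * d)" "param_poly_eval v (b * d) \<noteq> 0"
    using f g by simp_all
  show "regular_at v (f + g)" using fg unfolding regular_at_def by metis
  have "ratfun_eval v (f + g) = param_poly_eval v (a * d + c * b) / param_poly_eval v (b * d)"
    unfolding fg(1) by (rule ratfun_eval_Fract[OF fg(2)])
  also have "\<dots> = ratfun_eval v f + ratfun_eval v g"
    unfolding f(4) g(4) using f(3) g(3) by (simp add: field_simps)
  finally show "ratfun_eval v (f + g) = ratfun_eval v f + ratfun_eval v g" .
qed

lemma regular_eval_mult:
  assumes "regular_at v f" "regular_at v g"
  shows regular_mult [simp]: "regular_at v (f * g)"
    and ratfun_eval_mult [simp]: "ratfun_eval v (f * g) = ratfun_eval v f * ratfun_eval v g"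
proof -
  obtain a b where f: "f = Fract a b" "b \<noteq> 0" "param_poly_eval v b \<noteq> 0"
    "ratfun_eval v f = param_poly_eval v a / param_poly_eval v b"
    using assms(1) by (rule regular_atE)
  obtain c d where g: "g = Fract c d" "d \<noteq> 0" "param_poly_eval v d \<noteq> 0"
    "ratfun_eval v g = param_poly_eval v c / param_poly_eval v d"
    using assms(2) by (rule regular_atE)
  have fg: "f * g = Fract (a * c) (b * d)" "param_poly_eval v (b * d) \<noteq> 0"
    using f g by simp_all
  show "regular_at v (f * g)" using fg unfolding regular_at_def by metis
  have "ratfun_eval v (f * g) = param_poly_eval v (a * c) / param_poly_eval v (b * d)"
    unfolding fg(1) by (rule ratfun_eval_Fract[OF fg(2)])
  also have "\<dots> = ratfun_eval v f * ratfun_eval v g"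
    unfolding f(4) g(4) by simp
  finally show "ratfun_eval v (f * g) = ratfun_eval v f * ratfun_eval v g" .
qed

lemma regular_eval_uminus:
  assumes "regular_at v f"
  shows regular_uminus [simp]: "regular_at v (- f)"
    and ratfun_eval_uminus [simp]: "ratfun_eval v (- f) = - ratfun_eval v f"
proof -
  have m1: "- 1 = Fract (- 1 :: param_poly) 1"
    by (simp add: One_fract_def)
  have "regular_at v (- 1)" "ratfun_eval v (- 1) = - 1"
    unfolding m1 by (simp_all only: regular_eval_Fract1 param_poly_eval_uminus param_poly_eval_1)
  then show "regular_at v (- f)" "ratfun_eval v (- f) = - ratfun_eval v f"
    using regular_eval_mult[of v "- 1" f] assms by simp_all
qed

lemma regular_eval_diff:
  assumes "regular_at v f" "regular_at v g"
  shows regular_diff [simp]: "regular_at v (f - g)"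
    and ratfun_eval_diff [simp]: "ratfun_eval v (f - g) = ratfun_eval v f - ratfun_eval v g"
  using regular_eval_add[of v f "- g"] assms by simp_all

lemma regular_eval_sum:
  assumes "\<And>x. x \<in> S \<Longrightarrow> regular_at v (f x)"
  shows regular_sum: "regular_at v (\<Sum>x\<in>S. f x)"
    and ratfun_eval_sum: "ratfun_eval v (\<Sum>x\<in>S. f x) = (\<Sum>x\<in>S. ratfun_eval v (f x))"
  using assms by (induction S rule: infinite_finite_induct) simp_all

lemma regular_eval_of_nat [simp]:
  "regular_at v (of_nat n)" "ratfun_eval v (of_nat n) = of_nat n"
  by (induction n) simp_all

lemma regular_eval_of_int [simp]:
  "regular_at v (of_int z)" "ratfun_eval v (of_int z) = of_int z"
  by (cases z rule: int_cases2; simp)+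

text \<open>
  A common nonvanishing point of all denominators and of the nonzero numerators is obtained from a
  single product of polynomials.
\<close>

lemma generic_point:
  assumes "finite F"
  obtains v where "\<And>f. f \<in> F \<Longrightarrow> regular_at v f" "\<And>f. f \<in> F \<Longrightarrow> ratfun_eval v f = 0 \<Longrightarrow> f = 0"
proof -
  have "\<exists>a b. f = Fract a b \<and> b \<noteq> 0" for f :: param_ratfun
    by (cases f rule: Fract_cases) auto
  then obtain num den where nd: "\<And>f :: param_ratfun. f = Fract (num f) (den f) \<and> den f \<noteq> 0"
    by metis
  \<comment> \<open>A zero numerator is replaced by 1, so that it does not annihilate the product.\<close>
  define h where "h f = (if num f = 0 then 1 else num f) * den f" for f
  have "(\<Prod>f\<in>F. h f) \<noteq> 0"
    using nd by (subst prod_zero_iff[OF assms]) (auto simp: h_def)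
  then obtain v where "param_poly_eval v (\<Prod>f\<in>F. h f) \<noteq> 0"
    by (rule param_poly_nonvanishing)
  then have h: "param_poly_eval v (h f) \<noteq> 0" if "f \<in> F" for f
    using that assms by auto
  show ?thesis
  proof
    fix f assume f: "f \<in> F"
    have den: "param_poly_eval v (den f) \<noteq> 0" using h[OF f] by (simp add: h_def)
    then show "regular_at v f" using nd unfolding regular_at_def by metis
    assume "ratfun_eval v f = 0"
    then have "param_poly_eval v (num f) = 0"
      using ratfun_eval_Fract[OF den, of "num f"] nd[of f] den by simp
    then have "num f = 0" using h[OF f] by (auto simp: h_def split: if_splits)
    then show "f = 0" using nd[of f] by (metis fract_collapse(1))
  qed
qed

section \<open>Existence and uniqueness of the Jacobi-Pineiro polynomials\<close>

text \<open>
  Specialization is a ring homomorphism only on rational functions without pole at the given point,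
  hence regularity of all coefficients has to be carried along.
\<close>

lemma ratfun_eval_euler_steps:
  assumes "regular_at v s" "\<forall>c\<in>set cs. regular_at v c" "\<forall>n. regular_at v (coeff q n)"
  shows regular_euler_steps: "\<forall>n. regular_at v (coeff (euler_steps s cs q) n)"
    and map_poly_euler_steps: "map_poly (ratfun_eval v) (euler_steps s cs q) =
      euler_steps (ratfun_eval v s) (map (ratfun_eval v) cs) (map_poly (ratfun_eval v) q)"
  using assms
proof (induction cs arbitrary: s q)
  case (Cons c cs)
  {
    fix s c q assume reg: "regular_at v s" "regular_at v c" "\<forall>n. regular_at v (coeff q n)"
    have "\<forall>n. regular_at v (coeff (euler_step s c q) n)"
      using reg by (simp add: coeff_euler_step)
    moreover have "map_poly (ratfun_eval v) (euler_step s c q) =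
        euler_step (ratfun_eval v s) (ratfun_eval v c) (map_poly (ratfun_eval v) q)"
      using reg by (intro poly_eqI) (simp add: coeff_map_poly coeff_euler_step)
    note calculation this
  }
  note step = this
  {
    case 1
    then show ?case using Cons.IH(1)[of "s - 1" "euler_step s c q"] step(1)[of s c q] by simp
  next
    case 2
    then show ?case using Cons.IH(2)[of "s - 1" "euler_step s c q"] step[of s c q] by simp
  }
qed simp_all

lemma ratfun_eval_block_shifts:
  assumes "regular_at v a"
  shows "(\<forall>c\<in>set (block_shifts n a). regular_at v c) \<and>
    map (ratfun_eval v) (block_shifts n a) = block_shifts n (ratfun_eval v a)"
  using assms by (induction n) (simp_all del: of_nat_Suc)

lemma ratfun_eval_jp_shifts:
  assumes "\<forall>i\<in>{1..r}. regular_at v (m i)" "set is \<subseteq> {1..r}"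
  shows "(\<forall>c\<in>set (jp_shifts r m l is). regular_at v c) \<and>
    map (ratfun_eval v) (jp_shifts r m l is) = jp_shifts r (\<lambda>i. ratfun_eval v (m i)) l is"
  using assms(2)
proof (induction "is")
  case (Cons i "is")
  have m: "regular_at v (m j)" if "j \<in> {1..i}" for j
    using assms(1) Cons.prems that by auto
  have "regular_at v (\<Sum>j=1..i. m j)"
    and "ratfun_eval v (\<Sum>j=1..i. m j) = (\<Sum>j=1..i. ratfun_eval v (m j))"
    by (rule regular_eval_sum, erule m)+
  then have "regular_at v ((\<Sum>j=1..i. m j) + of_nat i)"
    and "ratfun_eval v ((\<Sum>j=1..i. m j) + of_nat i) = (\<Sum>j=1..i. ratfun_eval v (m j)) + of_nat i"
    by (simp_all del: One_nat_def)
  with ratfun_eval_block_shifts[OF this(1)] Cons show ?case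
    by (auto simp: jp_shifts_def simp del: One_nat_def)
qed (simp add: jp_shifts_def)

lemma ratfun_eval_jp_unnorm:
  assumes "\<forall>i\<in>{1..r}. regular_at v (m i)" "regular_at v k"
  shows "map_poly (ratfun_eval v) (jp_unnorm r m l k) =
    jp_unnorm r (\<lambda>i. ratfun_eval v (m i)) l (ratfun_eval v k)"
proof -
  have one: "map_poly (ratfun_eval v) 1 = 1"
    by (rule poly_eqI) (simp add: coeff_map_poly)
  have "set [1..<Suc r] \<subseteq> {1..r}" by auto
  note shifts = ratfun_eval_jp_shifts[OF assms(1) this, of l]
  show ?thesis
    unfolding jp_unnorm_def using assms(2) shifts
    by (subst map_poly_euler_steps) (auto simp: one simp del: upt_Suc One_nat_def)
qed

lemma coeffs_all_imp_coeff: "(\<And>f. f \<in> set (coeffs p) \<Longrightarrow> R f) \<Longrightarrow> R 0 \<Longrightarrow> R (coeff p n)"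
  by (metis range_coeff rangeI insertE)

text \<open>
  The factor of proportionality is the leading coefficient. Where it and the coefficients of the
  monic polynomial are regular, their product specializes correctly even if the leading coefficient
  vanishes there.
\<close>

lemma is_jacobi_pineiro_jp_monic:
  assumes "generic_params r m k" "r \<ge> 1" "is_part r l"
  shows "is_jacobi_pineiro r m l k (jp_monic r m l k)"
proof -
  let ?P = "jp_monic r m l k" and ?L = "jp_lead r m l k"
  have L: "?L \<noteq> 0" by (rule jp_lead_nonzero[OF assms(1)])
  have lead: "coeff ?P (l 1) = 1"
    using L by (simp add: jp_monic_def coeff_jp_unnorm[OF assms(3,2)] del: One_nat_def)
  have "degree ?P \<le> l 1"
    using degree_jp_unnorm_le[OF assms(3,2), of m k] by (simp add: jp_monic_def)
  moreover have "l 1 \<le> degree ?P"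
    by (rule le_degree) (simp add: lead del: One_nat_def)
  ultimately have deg: "degree ?P = l 1" by simp
  moreover have "rodrigues r (\<lambda>j. ratfun_eval v (m j)) l (ratfun_eval v k) x =
      ratfun_eval v ?L * poly (map_poly (ratfun_eval v) ?P) x"
    if reg: "\<forall>f \<in> {?L, k} \<union> m ` {1..r} \<union> set (coeffs ?P). regular_at v f" and x: "x \<in> cut_plane" for v x
  proof -
    have "regular_at v (coeff ?P n)" for n
      by (rule coeffs_all_imp_coeff) (use reg in auto)
    then have "smult (ratfun_eval v ?L) (map_poly (ratfun_eval v) ?P) =
        map_poly (ratfun_eval v) (smult ?L ?P)"
      using reg by (intro poly_eqI) (simp add: coeff_map_poly)
    also have "smult ?L ?P = jp_unnorm r m l k"
      using L by (simp add: jp_monic_def)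
    also have "map_poly (ratfun_eval v) \<dots> = jp_unnorm r (\<lambda>i. ratfun_eval v (m i)) l (ratfun_eval v k)"
      using reg by (intro ratfun_eval_jp_unnorm) auto
    finally show ?thesis
      using rodrigues_eq_jp_unnorm[OF assms(3,2) x] by (metis poly_smult)
  qed
  ultimately show ?thesis
    unfolding is_jacobi_pineiro_def using L lead by metis
qed

text \<open>
  At a generic point both polynomials are, up to the factors of proportionality, given by the same
  function on the infinite cut plane. The point is chosen so that the coefficients of the difference
  vanish there only if they vanish identically.
\<close>

lemma is_jacobi_pineiro_unique:
  assumes "is_jacobi_pineiro r m l k P" "is_jacobi_pineiro r m l k Q"
  shows "P = Q"
proof -
  let ?reg = "\<lambda>v c P. \<forall>f \<in> {c, k} \<union> m ` {1..r} \<union> set (coeffs P). regular_at v f"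
  obtain c where c: "c \<noteq> 0" "\<And>v x. ?reg v c P \<Longrightarrow> x \<in> cut_plane \<Longrightarrow>
      rodrigues r (\<lambda>j. ratfun_eval v (m j)) l (ratfun_eval v k) x =
      ratfun_eval v c * poly (map_poly (ratfun_eval v) P) x"
    using assms(1) unfolding is_jacobi_pineiro_def by blast
  obtain d where d: "\<And>v x. ?reg v d Q \<Longrightarrow> x \<in> cut_plane \<Longrightarrow>
      rodrigues r (\<lambda>j. ratfun_eval v (m j)) l (ratfun_eval v k) x =
      ratfun_eval v d * poly (map_poly (ratfun_eval v) Q) x"
    using assms(2) unfolding is_jacobi_pineiro_def by blast
  let ?R = "smult c P - smult d Q"
  let ?F = "{c, d, k} \<union> m ` {1..r} \<union> set (coeffs P) \<union> set (coeffs Q) \<union> set (coeffs ?R)"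
  have "finite ?F" by simp
  then obtain v where v: "\<And>f. f \<in> ?F \<Longrightarrow> regular_at v f" "\<And>f. f \<in> ?F \<Longrightarrow> ratfun_eval v f = 0 \<Longrightarrow> f = 0"
    by (rule generic_point[OF _ that])
  have reg: "regular_at v (coeff P n)" "regular_at v (coeff Q n)" for n
    by (rule coeffs_all_imp_coeff; use v(1) in simp)+
  have "map_poly (ratfun_eval v) ?R =
      smult (ratfun_eval v c) (map_poly (ratfun_eval v) P) - smult (ratfun_eval v d) (map_poly (ratfun_eval v) Q)"
    using reg v(1) by (intro poly_eqI) (simp add: coeff_map_poly)
  moreover have "ratfun_eval v c * poly (map_poly (ratfun_eval v) P) x =
      ratfun_eval v d * poly (map_poly (ratfun_eval v) Q) x" if "x \<in> cut_plane" for x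
  proof -
    have "?reg v c P" "?reg v d Q" using v(1) by auto
    then show ?thesis using c(2)[OF _ that] d[OF _ that] by metis
  qed
  ultimately have "cut_plane \<subseteq> {x. poly (map_poly (ratfun_eval v) ?R) x = 0}"
    by auto
  then have "map_poly (ratfun_eval v) ?R = 0"
    using infinite_cut_plane poly_roots_finite finite_subset by blast
  then have "ratfun_eval v (coeff ?R n) = 0" for n
    by (metis coeff_0 coeff_map_poly regular_eval_0(2))
  moreover have "ratfun_eval v (coeff ?R n) = 0 \<longrightarrow> coeff ?R n = 0" for n
    by (rule coeffs_all_imp_coeff) (use v(2) in auto)
  ultimately have "coeff ?R n = 0" for n
    by blast
  then have "?R = 0" by (intro poly_eqI) (simp only: coeff_0)
  then have eq: "smult c P = smult d Q" by simp
  have lead: "degree P = l 1" "degree Q = l 1" "lead_coeff P = 1" "lead_coeff Q = 1"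
    using assms by (auto simp: is_jacobi_pineiro_def)
  have "c = d"
    using arg_cong[OF eq, of "\<lambda>p. coeff p (l 1)"] lead by simp
  then show "P = Q" using eq c(1) by (metis smult_cancel)
qed

lemma jacobi_pineiro_eq:
  assumes "generic_params r m k" "r \<ge> 1" "is_part r l"
  shows "jacobi_pineiro r m l k = jp_monic r m l k"
  unfolding jacobi_pineiro_def
  using is_jacobi_pineiro_jp_monic[OF assms] is_jacobi_pineiro_unique by blast

text \<open>
  Specializing \<open>k\<close> to the imaginary unit and every \<open>m\<^sub>j\<close> to \<open>0\<close> yields a number that is not an
  integer.
\<close>

lemma generic_params_param: "generic_params r param (param 0)"
  unfolding generic_params_def
proof (intro ballI allI notI)
  fix i z assume eq: "param 0 + (\<Sum>j=1..i. param j) = of_int z"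
  define v where "v = (\<lambda>j::nat. if j = 0 then \<i> else 0)"
  have "ratfun_eval v (param 0 + (\<Sum>j=1..i. param j)) = \<i>"
    by (simp add: regular_sum ratfun_eval_sum v_def)
  then have "of_int z = \<i>"
    unfolding eq by simp
  from arg_cong[OF this, of Im] show False by simp
qed

theorem proposition4p10:
  fixes r i :: nat and l :: "nat \<Rightarrow> nat"
  assumes "r \<ge> 1" and "is_part r l" and "i \<le> r"
  shows "jp_D r param l (param 0) i (jacobi_pineiro r param l (param 0)) =
    smult (jp_A r param l (param 0) i)
      (jacobi_pineiro r param (add_ones l i) (param 0 + 1))"
  using jp_D_jp_monic[OF generic_params_param assms]
    jacobi_pineiro_eq[OF generic_params_param assms(1,2)]
    jacobi_pineiro_eq[OF generic_params_Suc[OF generic_params_param] assms(1) is_part_add_ones[OF assms(2)]]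
  by simp

end
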